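(* Let $k\ge1$ and let $\Sigma_{\mathcal R}=(M,T,Fe)$ be a classical Riemannian mechanical system, with $T=\frac12\gamma_{ij}(x)\frac{dx^i}{dt}\frac{dx^j}{dt}$, whose external forces $Fe=F^i(x,y^{(1)},\dots,y^{(k)})\frac{\partial}{\partial y^{(k)i}}$ depend on the accelerations of order up to $k$. Let $L=\gamma_{ij}(x)z^{(k)i}z^{(k)j}$ be the prolonged Lagrangian of order $k$. The Lagrange equations of $\Sigma_{\mathcal R}$, i.e. $$\frac{d}{dt}\left(\frac{\partial L}{\partial y^{(k)i}}\right)-\frac{\partial L}{\partial y^{(k-1)i}}=F_i(x,y^{(1)},\dots,y^{(k)}),\qquad y^{(\alpha)i}=\frac1{\alpha!}\frac{d^\alpha x^i}{dt^\alpha}\ (\alpha=1,\dots,k),$$ are given by (are equivalent to) $$\frac{d^{k+1}x^i}{dt^{k+1}}+(k+1)!\,\mathring G^i(x,y^{(1)},\dots,y^{(k)})=\frac12k!\,F^i(x,y^{(1)},\dots,y^{(k)}),\qquad y^{(\alpha)i}=\frac1{\alpha!}\frac{d^\alpha x^i}{dt^\alpha}\ (\alpha=1,\dots,k),$$ where $$(k+1)\mathring G^i=\frac12\gamma^{ij}\left[\Gamma\left(\frac{\partial L}{\partial y^{(k)j}}\right)-\frac{\partial L}{\partial y^{(k-1)j}}\right].$$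
   Context: The summation convention is used. $M$ is a real $n$-dimensional smooth manifold with Riemannian metric $\gamma_{ij}(x)$, inverse $\gamma^{ij}(x)$ and Christoffel symbols $\gamma^i_{jm}(x)$. $T^kM$ is the bundle of accelerations of order $k$ (the manifold of $k$-jets at $0$ of curves in $M$), with local coordinates $(x^i,y^{(1)i},\dots,y^{(k)i})$, where the $k$-jet of a curve $x(t)$ has $y^{(\alpha)i}=\frac1{\alpha!}\frac{d^\alpha x^i}{dt^\alpha}(0)$; $y^{(0)i}=x^i$. Let $\Gamma=y^{(1)i}\frac{\partial}{\partial x^i}+2y^{(2)i}\frac{\partial}{\partial y^{(1)i}}+\dots+ky^{(k)i}\frac{\partial}{\partial y^{(k-1)i}}$. Define the dual coefficients $\underset{(1)}{M}{}^i_j=\gamma^i_{jm}(x)y^{(1)m}$ and, for $\alpha=2,\dots,k$, $\underset{(\alpha)}{M}{}^i_j=\frac1\alpha\left(\Gamma\underset{(\alpha-1)}{M}{}^i_j+\underset{(1)}{M}{}^i_m\underset{(\alpha-1)}{M}{}^m_j\right)$, and the Liouville $d$-vector field $z^{(k)i}$ by $kz^{(k)i}=ky^{(k)i}+(k-1)\underset{(1)}{M}{}^i_my^{(k-1)m}+\dots+\underset{(k-1)}{M}{}^i_my^{(1)m}$ (so $z^{(1)i}=y^{(1)i}$ when $k=1$). The covariant components of the forces are $F_i=\gamma_{ij}F^j$. By the paper's postulate, the Lagrange equations of $\Sigma_{\mathcal R}$ are those of its prolongation of order $k$, namely of the Lagrangian $L=\gamma_{ij}(x)z^{(k)i}z^{(k)j}$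 with forces $Fe$, as displayed in the claim. *)

theory Defs
  imports "HOL-Analysis.Analysis"
begin

text \<open>Only meaningful for open \<open>S\<close>: the derivatives are taken at \<open>x\<close>, not within \<open>S\<close>.\<close>

primrec Ck_on :: "nat \<Rightarrow> 'a::euclidean_space set \<Rightarrow> ('a \<Rightarrow> 'b::real_normed_vector) \<Rightarrow> bool" where
  "Ck_on 0 S f \<longleftrightarrow> continuous_on S f"
| "Ck_on (Suc r) S f \<longleftrightarrow> (\<forall>x\<in>S. f differentiable (at x)) \<and>
     (\<forall>e\<in>Basis. Ck_on r S (\<lambda>x. frechet_derivative f (at x) e))"

definition smooth_on :: "'a::euclidean_space set \<Rightarrow> ('a \<Rightarrow> 'b::real_normed_vector) \<Rightarrow> bool" where
  "smooth_on S f \<longleftrightarrow> (\<forall>r. Ck_on r S f)"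

text \<open>The manifold is the whole type \<open>'m\<close>, its dimension is \<open>CARD('n)\<close>. A chart is a pair of its
  domain and its coordinate map; the values of the latter off the domain are irrelevant.\<close>

type_synonym ('m, 'n) chart = "'m set \<times> ('m \<Rightarrow> real ^ 'n)"

definition transition :: "('m, 'n) chart \<Rightarrow> ('m, 'n) chart \<Rightarrow> real ^ 'n \<Rightarrow> real ^ 'n" where
  "transition a b = snd b \<circ> inv_into (fst a) (snd a)"

definition smooth_atlas ::
    "('m::{t2_space, second_countable_topology}, 'n::finite) chart set \<Rightarrow> bool" where
  "smooth_atlas A \<longleftrightarrow>
     \<Union> (fst ` A) = UNIV \<and>
     (\<forall>(U, \<phi>)\<in>A. open U \<and> open (\<phi> ` U) \<and> homeomorphism U (\<phi> ` U) \<phi> (inv_into U \<phi>)) \<and>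
     (\<forall>(U, \<phi>)\<in>A. \<forall>(V, \<psi>)\<in>A. smooth_on (\<phi> ` (U \<inter> V)) (transition (U, \<phi>) (V, \<psi>)))"

definition Ck_curve ::
    "('m::topological_space, 'n::finite) chart set \<Rightarrow> nat \<Rightarrow> real set \<Rightarrow> (real \<Rightarrow> 'm) \<Rightarrow> bool" where
  "Ck_curve A r I c \<longleftrightarrow> open I \<and> is_interval I \<and> continuous_on I c \<and>
     (\<forall>(U, \<phi>)\<in>A. Ck_on r {t \<in> I. c t \<in> U} (\<phi> \<circ> c))"

definition smooth_curve ::
    "('m::topological_space, 'n::finite) chart set \<Rightarrow> real set \<Rightarrow> (real \<Rightarrow> 'm) \<Rightarrow> bool" where
  "smooth_curve A I c \<longleftrightarrow> (\<forall>r. Ck_curve A r I c)"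

text \<open>A metric is given by its matrix of covariant components \<open>\<gamma>\<^sub>i\<^sub>j(x)\<close> in every chart; the last
  clause is the transformation law of a tensor of type (0,2).\<close>

definition riemannian_metric ::
    "('m::topological_space, 'n::finite) chart set \<Rightarrow>
     (('m, 'n) chart \<Rightarrow> real ^ 'n \<Rightarrow> real ^ 'n ^ 'n) \<Rightarrow> bool" where
  "riemannian_metric A g \<longleftrightarrow>
     (\<forall>(U, \<phi>)\<in>A. smooth_on (\<phi> ` U) (g (U, \<phi>)) \<and>
        (\<forall>x\<in>\<phi> ` U. transpose (g (U, \<phi>) x) = g (U, \<phi>) x \<and>
           (\<forall>v. v \<noteq> 0 \<longrightarrow> v \<bullet> (g (U, \<phi>) x *v v) > 0))) \<and>
     (\<forall>(U, \<phi>)\<in>A. \<forall>(V, \<psi>)\<in>A. \<forall>p\<in>U \<inter> V. \<forall>v w.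
        (let D = frechet_derivative (transition (U, \<phi>) (V, \<psi>)) (at (\<phi> p)) in
         v \<bullet> (g (U, \<phi>) (\<phi> p) *v w) = D v \<bullet> (g (V, \<psi>) (\<psi> p) *v D w)))"

text \<open>A point \<open>(x, y\<^sup>(\<^sup>1\<^sup>), \<dots>, y\<^sup>(\<^sup>k\<^sup>))\<close> of a coordinate neighbourhood of \<open>T\<^sup>kM\<close> is
  encoded as the sequence \<open>y\<close> with \<open>y 0 = x\<close>, \<open>y \<alpha> = y\<^sup>(\<^sup>\<alpha>\<^sup>)\<close> for \<open>1 \<le> \<alpha> \<le> k\<close>, and \<open>y \<alpha> = 0\<close> for
  \<open>\<alpha> > k\<close>.\<close>

type_synonym 'n jet = "nat \<Rightarrow> real ^ 'n"

definition higher_deriv :: "nat \<Rightarrow> (real \<Rightarrow> 'a::real_normed_vector) \<Rightarrow> real \<Rightarrow> 'a" where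
  "higher_deriv r x = ((\<lambda>f t. vector_derivative f (at t)) ^^ r) x"

definition jet :: "nat \<Rightarrow> (real \<Rightarrow> real ^ 'n) \<Rightarrow> real \<Rightarrow> 'n::finite jet" where
  "jet k x t = (\<lambda>\<alpha>. if \<alpha> \<le> k then (1 / fact \<alpha>) *\<^sub>R higher_deriv \<alpha> x t else 0)"

text \<open>This is \<open>\<partial>f/\<partial>y\<^sup>(\<^sup>\<alpha>\<^sup>)\<^sup>i\<close>; for \<open>\<alpha> = 0\<close> it is \<open>\<partial>f/\<partial>x\<^sup>i\<close>.\<close>

definition jet_pd :: "nat \<Rightarrow> 'n::finite \<Rightarrow> ('n jet \<Rightarrow> real) \<Rightarrow> 'n jet \<Rightarrow> real" where
  "jet_pd \<alpha> i f y = deriv (\<lambda>s. f (y(\<alpha> := y \<alpha> + s *\<^sub>R axis i 1))) 0"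

definition Gamma_op :: "nat \<Rightarrow> ('n::finite jet \<Rightarrow> real) \<Rightarrow> 'n jet \<Rightarrow> real" where
  "Gamma_op k f y = (\<Sum>\<alpha>=1..k. \<Sum>i\<in>UNIV. real \<alpha> * y \<alpha> $ i * jet_pd (\<alpha> - 1) i f y)"

text \<open>A force \<open>F\<^sup>i \<partial>/\<partial>y\<^sup>(\<^sup>k\<^sup>)\<^sup>i\<close> is given by its components in every chart. Under a change of
  coordinates \<open>\<partial>/\<partial>y\<^sup>(\<^sup>k\<^sup>)\<^sup>i\<close> transforms like \<open>\<partial>/\<partial>x\<^sup>i\<close>, so the \<open>F\<^sup>i\<close> are multiplied by the
  Jacobian matrix of the transition map of \<open>M\<close>. Corresponding points in the two coordinate
  systems of \<open>T\<^sup>kM\<close> are those which represent the \<open>k\<close>-jet at \<open>0\<close> of the same curve.\<close>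

definition force_field ::
    "('m::topological_space, 'n::finite) chart set \<Rightarrow> nat \<Rightarrow>
     (('m, 'n) chart \<Rightarrow> 'n jet \<Rightarrow> real ^ 'n) \<Rightarrow> bool" where
  "force_field A k F \<longleftrightarrow>
     (\<forall>(U, \<phi>)\<in>A. \<forall>(V, \<psi>)\<in>A. \<forall>I c. smooth_curve A I c \<and> 0 \<in> I \<and> c 0 \<in> U \<inter> V \<longrightarrow>
        F (V, \<psi>) (jet k (\<psi> \<circ> c) 0) =
        frechet_derivative (transition (U, \<phi>) (V, \<psi>)) (at (\<phi> (c 0)))
          (F (U, \<phi>) (jet k (\<phi> \<circ> c) 0)))"

text \<open>The kinetic energy \<open>T\<close> is a function of a chart, the position \<open>x\<close> and the velocity
  \<open>v = dx/dt\<close>.\<close>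

definition riemannian_mechanical_system ::
    "('m::{t2_space, second_countable_topology}, 'n::finite) chart set \<Rightarrow>
     (('m, 'n) chart \<Rightarrow> real ^ 'n \<Rightarrow> real ^ 'n ^ 'n) \<Rightarrow>
     (('m, 'n) chart \<Rightarrow> real ^ 'n \<Rightarrow> real ^ 'n \<Rightarrow> real) \<Rightarrow>
     nat \<Rightarrow> (('m, 'n) chart \<Rightarrow> 'n jet \<Rightarrow> real ^ 'n) \<Rightarrow> bool" where
  "riemannian_mechanical_system A g T k F \<longleftrightarrow>
     smooth_atlas A \<and> riemannian_metric A g \<and>
     (\<forall>(U, \<phi>)\<in>A. \<forall>x\<in>\<phi> ` U. \<forall>v.
        T (U, \<phi>) x v = 1/2 * (\<Sum>i\<in>UNIV. \<Sum>j\<in>UNIV. g (U, \<phi>) x $ i $ j * v $ i * v $ j)) \<and>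
     force_field A k F"

text \<open>Below, \<open>\<gamma>\<close> is the matrix of components of the metric in one fixed chart.\<close>

definition metric_pd :: "(real ^ 'n \<Rightarrow> real ^ 'n ^ 'n) \<Rightarrow> 'n \<Rightarrow> 'n \<Rightarrow> 'n::finite \<Rightarrow> real ^ 'n \<Rightarrow> real" where
  "metric_pd \<gamma> i j m x = deriv (\<lambda>s. \<gamma> (x + s *\<^sub>R axis m 1) $ i $ j) 0"

definition christoffel :: "(real ^ 'n \<Rightarrow> real ^ 'n ^ 'n) \<Rightarrow> 'n \<Rightarrow> 'n \<Rightarrow> 'n::finite \<Rightarrow> real ^ 'n \<Rightarrow> real" where
  "christoffel \<gamma> i j m x = 1/2 * (\<Sum>l\<in>UNIV. matrix_inv (\<gamma> x) $ i $ l *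
     (metric_pd \<gamma> l m j x + metric_pd \<gamma> j l m x - metric_pd \<gamma> j m l x))"

text \<open>The dual coefficients are indexed by \<open>1, \<dots>, k\<close>; the value at index \<open>0\<close> is a dummy.\<close>

fun dual_coeff ::
    "nat \<Rightarrow> (real ^ 'n \<Rightarrow> real ^ 'n ^ 'n) \<Rightarrow> nat \<Rightarrow> 'n \<Rightarrow> 'n \<Rightarrow> 'n::finite jet \<Rightarrow> real" where
  "dual_coeff k \<gamma> 0 i j y = 0"
| "dual_coeff k \<gamma> (Suc 0) i j y = (\<Sum>m\<in>UNIV. christoffel \<gamma> i j m (y 0) * y 1 $ m)"
| "dual_coeff k \<gamma> (Suc (Suc \<alpha>)) i j y = 1 / real (Suc (Suc \<alpha>)) *
     (Gamma_op k (dual_coeff k \<gamma> (Suc \<alpha>) i j) y +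
      (\<Sum>m\<in>UNIV. dual_coeff k \<gamma> (Suc 0) i m y * dual_coeff k \<gamma> (Suc \<alpha>) m j y))"

definition liouville :: "nat \<Rightarrow> (real ^ 'n \<Rightarrow> real ^ 'n ^ 'n) \<Rightarrow> 'n \<Rightarrow> 'n::finite jet \<Rightarrow> real" where
  "liouville k \<gamma> i y = 1 / real k * (real k * y k $ i +
     (\<Sum>\<alpha>=1..<k. real (k - \<alpha>) * (\<Sum>m\<in>UNIV. dual_coeff k \<gamma> \<alpha> i m y * y (k - \<alpha>) $ m)))"

definition lagrangian :: "nat \<Rightarrow> (real ^ 'n \<Rightarrow> real ^ 'n ^ 'n) \<Rightarrow> 'n::finite jet \<Rightarrow> real" where
  "lagrangian k \<gamma> y =
     (\<Sum>i\<in>UNIV. \<Sum>j\<in>UNIV. \<gamma> (y 0) $ i $ j * liouville k \<gamma> i y * liouville k \<gamma> j y)"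

definition spray_coeff :: "nat \<Rightarrow> (real ^ 'n \<Rightarrow> real ^ 'n ^ 'n) \<Rightarrow> 'n \<Rightarrow> 'n::finite jet \<Rightarrow> real" where
  "spray_coeff k \<gamma> i y = 1 / real (k + 1) * (1/2 * (\<Sum>j\<in>UNIV. matrix_inv (\<gamma> (y 0)) $ i $ j *
     (Gamma_op k (jet_pd k j (lagrangian k \<gamma>)) y - jet_pd (k - 1) j (lagrangian k \<gamma>) y)))"

definition lower_index :: "(real ^ 'n \<Rightarrow> real ^ 'n ^ 'n) \<Rightarrow> ('n jet \<Rightarrow> real ^ 'n) \<Rightarrow> 'n \<Rightarrow> 'n::finite jet \<Rightarrow> real" where
  "lower_index \<gamma> F i y = (\<Sum>j\<in>UNIV. \<gamma> (y 0) $ i $ j * F y $ j)"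

end

theory Submission imports Defs begin

text \<open>The Lagrange equations and the equations of motion are two forms of one linear system for the
  highest derivative \<open>x\<^sup>(\<^sup>k\<^sup>+\<^sup>1\<^sup>)\<close>. Each dual coefficient of index \<open>\<alpha> < k\<close> depends only on
  \<open>x, y\<^sup>(\<^sup>1\<^sup>), \<dots>, y\<^sup>(\<^sup>\<alpha>\<^sup>)\<close>, so \<open>z\<^sup>(\<^sup>k\<^sup>) = y\<^sup>(\<^sup>k\<^sup>) + r\<close> where \<open>r\<close> does not involve \<open>y\<^sup>(\<^sup>k\<^sup>)\<close>. Therefore the
  momenta \<open>p\<^sub>i = \<partial>L/\<partial>y\<^sup>(\<^sup>k\<^sup>)\<^sup>i\<close> equal \<open>2 \<gamma>\<^sub>i\<^sub>j z\<^sup>(\<^sup>k\<^sup>)\<^sup>j\<close>, and their derivatives by \<open>y\<^sup>(\<^sup>k\<^sup>)\<^sup>j\<close> are \<open>2 \<gamma>\<^sub>i\<^sub>j\<close>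
  (lemma \<open>jet_pd_lagrangian\<close>).

  Along the jet of a curve the derivative of \<open>y\<^sup>(\<^sup>\<alpha>\<^sup>)\<close> is \<open>(\<alpha> + 1) y\<^sup>(\<^sup>\<alpha>\<^sup>+\<^sup>1\<^sup>)\<close> for \<open>\<alpha> < k\<close>, and that of \<open>y\<^sup>(\<^sup>k\<^sup>)\<close>
  is \<open>x\<^sup>(\<^sup>k\<^sup>+\<^sup>1\<^sup>) / k!\<close>. By the chain rule \<open>d/dt\<close> therefore acts on functions of jets as \<open>\<Gamma>\<close> plus a term
  in \<open>x\<^sup>(\<^sup>k\<^sup>+\<^sup>1\<^sup>)\<close> (lemma \<open>deriv_along_jet\<close>), which turns the Lagrange equations into
  \<open>a\<^sub>i + (2 / k!) \<gamma>\<^sub>i\<^sub>j x\<^sup>(\<^sup>k\<^sup>+\<^sup>1\<^sup>)\<^sup>j = \<gamma>\<^sub>i\<^sub>j F\<^sup>j\<close> with \<open>a\<^sub>i = \<Gamma> p\<^sub>i - \<partial>L/\<partial>y\<^sup>(\<^sup>k\<^sup>-\<^sup>1\<^sup>)\<^sup>i\<close>. The metric being positive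
  definite, this can be solved for \<open>x\<^sup>(\<^sup>k\<^sup>+\<^sup>1\<^sup>)\<close> by applying \<open>(k! / 2) \<gamma>\<^sup>-\<^sup>1\<close>, and \<open>\<gamma>\<^sup>-\<^sup>1 a\<close> is
  \<open>2 (k + 1)\<close> times the spray coefficient.

  What needs work is the chain rule: jets are infinite sequences, without a norm, and the recursion
  for the dual coefficients differentiates repeatedly. The proof uses an algebra of functions of
  \<open>x, y\<^sup>(\<^sup>1\<^sup>), \<dots>, y\<^sup>(\<^sup>m\<^sup>)\<close> (predicate \<open>smooth_jet_fun\<close>) that contains
  everything built from the metric, is closed under partial derivatives, and satisfies the chain
  rule along curves of jets.\<close>

section \<open>Smooth maps\<close>

lemma Ck_on_cong:
  assumes "open S" "Ck_on r S f" "\<And>x. x \<in> S \<Longrightarrow> f x = g x"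
  shows "Ck_on r S g"
  using assms(2,3)
proof (induction r arbitrary: f g)
  case 0
  then show ?case by (metis Ck_on.simps(1) continuous_on_cong)
next
  case (Suc r)
  have der: "(f has_derivative D) (at x) \<longleftrightarrow> (g has_derivative D) (at x)" if "x \<in> S" for x D
    using has_derivative_transform_within_open[OF _ \<open>open S\<close> that, of f D UNIV g]
      has_derivative_transform_within_open[OF _ \<open>open S\<close> that, of g D UNIV f] Suc.prems(2)
    by auto
  have fd: "frechet_derivative f (at x) = frechet_derivative g (at x)" if "x \<in> S" for x
    by (simp add: frechet_derivative_def der[OF that])
  have "g differentiable (at x)" if "x \<in> S" for x
  proof -
    have "f differentiable (at x)" using Suc.prems(1) that by simp
    then show ?thesis unfolding differentiable_def der[OF that] .
  qed
  moreover have "Ck_on r S (\<lambda>x. frechet_derivative g (at x) e)" if "e \<in> Basis" for e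
    by (rule Suc.IH[of "\<lambda>x. frechet_derivative f (at x) e"]) (use Suc.prems(1) that fd in auto)
  ultimately show ?case by simp
qed

lemma Ck_on_bounded_linear:
  assumes "open S" "bounded_linear L" "Ck_on r S f"
  shows "Ck_on r S (\<lambda>x. L (f x))"
  using assms(3)
proof (induction r arbitrary: f)
  case 0
  then show ?case
    using bounded_linear.continuous_on[OF assms(2)] by simp
next
  case (Suc r)
  have der: "((\<lambda>x. L (f x)) has_derivative (\<lambda>h. L (frechet_derivative f (at x) h))) (at x)"
    if "x \<in> S" for x
    using Suc.prems that bounded_linear.has_derivative[OF assms(2)]
    by (auto simp: frechet_derivative_works)
  have "Ck_on r S (\<lambda>x. frechet_derivative (\<lambda>x. L (f x)) (at x) e)" if "e \<in> Basis" for e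
  proof (rule Ck_on_cong[OF \<open>open S\<close>])
    show "Ck_on r S (\<lambda>x. L (frechet_derivative f (at x) e))"
      using Suc.prems that by (intro Suc.IH) auto
  qed (use der frechet_derivative_at in metis)
  then show ?case
    using der by (auto simp: differentiable_def)
qed

lemma Ck_on_const: "Ck_on r S (\<lambda>x. c)"
  by (induction r arbitrary: c) (auto simp: frechet_derivative_const)

text \<open>On the real line the only basis vector is \<open>1\<close>, and the Frechet derivative at \<open>1\<close> is the vector
  derivative, so \<open>\<alpha>\<close>-fold differentiation lowers the regularity by \<open>\<alpha>\<close>.\<close>

lemma higher_deriv_has_vector_derivative:
  fixes f :: "real \<Rightarrow> 'a::real_normed_vector"
  assumes "open S" "Ck_on r S f" "\<alpha> < r" "t \<in> S"
  shows "(higher_deriv \<alpha> f has_vector_derivative higher_deriv (Suc \<alpha>) f t) (at t)"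
proof -
  have "Ck_on (r - \<alpha>) S (higher_deriv \<alpha> f)" if "\<alpha> \<le> r" for \<alpha>
    using that
  proof (induction \<alpha>)
    case 0
    then show ?case using assms(2) by (simp add: higher_deriv_def)
  next
    case (Suc \<alpha>)
    then have *: "Ck_on (Suc (r - Suc \<alpha>)) S (higher_deriv \<alpha> f)"
      by (simp add: Suc_diff_Suc)
    show ?case
    proof (rule Ck_on_cong[OF assms(1)])
      show "Ck_on (r - Suc \<alpha>) S (\<lambda>x. frechet_derivative (higher_deriv \<alpha> f) (at x) 1)"
        using * by simp
    next
      fix x assume "x \<in> S"
      then show "frechet_derivative (higher_deriv \<alpha> f) (at x) 1 = higher_deriv (Suc \<alpha>) f x"
        using * by (simp add: higher_deriv_def frechet_derivative_eq_vector_derivative)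
    qed
  qed
  from this[of \<alpha>] have "Ck_on (Suc (r - Suc \<alpha>)) S (higher_deriv \<alpha> f)"
    using assms(3) by (simp add: Suc_diff_Suc)
  then have "higher_deriv \<alpha> f differentiable (at t)"
    using assms(4) by simp
  then show ?thesis
    by (simp add: higher_deriv_def vector_derivative_works)
qed

section \<open>Smooth functions on jet coordinates\<close>

text \<open>The algebra of functions on the jets over \<open>V\<close> that is generated by the smooth functions of
  \<open>x = y\<^sup>(\<^sup>0\<^sup>)\<close> and the coordinates up to order \<open>m\<close>. Reciprocals are included so that Cramer's rule
  puts the inverse metric into the algebra. The last rule makes membership depend only on the values
  over \<open>V\<close>, since partial derivatives can be computed only there.\<close>

inductive smooth_jet_fun :: "(real ^ 'n) set \<Rightarrow> nat \<Rightarrow> ('n::finite jet \<Rightarrow> real) \<Rightarrow> bool"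
  for V :: "(real ^ 'n) set" and m :: nat where
  base: "smooth_on V h \<Longrightarrow> smooth_jet_fun V m (\<lambda>y. h (y 0))"
| coord: "\<alpha> \<le> m \<Longrightarrow> smooth_jet_fun V m (\<lambda>y. y \<alpha> $ j)"
| add: "smooth_jet_fun V m f \<Longrightarrow> smooth_jet_fun V m g \<Longrightarrow> smooth_jet_fun V m (\<lambda>y. f y + g y)"
| mult: "smooth_jet_fun V m f \<Longrightarrow> smooth_jet_fun V m g \<Longrightarrow> smooth_jet_fun V m (\<lambda>y. f y * g y)"
| inverse: "smooth_jet_fun V m f \<Longrightarrow> (\<And>y. y 0 \<in> V \<Longrightarrow> f y \<noteq> 0) \<Longrightarrow>
    smooth_jet_fun V m (\<lambda>y. inverse (f y))"
| cong: "smooth_jet_fun V m f \<Longrightarrow> (\<And>y. y 0 \<in> V \<Longrightarrow> f y = g y) \<Longrightarrow> smooth_jet_fun V m g"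

lemma smooth_jet_fun_const: "smooth_jet_fun V m (\<lambda>y. c)"
  using smooth_jet_fun.base[of V "\<lambda>x. c" m] by (simp add: smooth_on_def Ck_on_const)

lemma smooth_jet_fun_minus: "smooth_jet_fun V m f \<Longrightarrow> smooth_jet_fun V m (\<lambda>y. - f y)"
  using smooth_jet_fun.mult[OF smooth_jet_fun_const[of V m "-1"]] by simp

lemma smooth_jet_fun_diff:
  "smooth_jet_fun V m f \<Longrightarrow> smooth_jet_fun V m g \<Longrightarrow> smooth_jet_fun V m (\<lambda>y. f y - g y)"
  using smooth_jet_fun.add[OF _ smooth_jet_fun_minus, of V m f g] by simp

lemma smooth_jet_fun_sum:
  "(\<And>a. a \<in> S \<Longrightarrow> smooth_jet_fun V m (f a)) \<Longrightarrow> smooth_jet_fun V m (\<lambda>y. \<Sum>a\<in>S. f a y)"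
  by (induction S rule: infinite_finite_induct)
    (auto intro: smooth_jet_fun_const smooth_jet_fun.add)

lemma smooth_jet_fun_prod:
  "(\<And>a. a \<in> S \<Longrightarrow> smooth_jet_fun V m (f a)) \<Longrightarrow> smooth_jet_fun V m (\<lambda>y. \<Prod>a\<in>S. f a y)"
  by (induction S rule: infinite_finite_induct)
    (auto intro: smooth_jet_fun_const smooth_jet_fun.mult)

lemma smooth_jet_fun_mono:
  assumes "smooth_jet_fun V m f" "m \<le> m'"
  shows "smooth_jet_fun V m' f"
  using assms by induction (auto intro: smooth_jet_fun.intros)

lemmas smooth_jet_fun_intros =
  smooth_jet_fun.coord smooth_jet_fun.add smooth_jet_fun.mult smooth_jet_fun_const
  smooth_jet_fun_minus smooth_jet_fun_diff smooth_jet_fun_sum smooth_jet_fun_prod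

text \<open>Curves of jets are differentiated coordinatewise and only up to order \<open>m\<close>. A function that
  satisfies this rule has over \<open>V\<close> the partial derivatives \<open>D\<close>, and those of order above \<open>m\<close> vanish, so the
  rule also expresses that the function does not depend on the higher coordinates.\<close>

definition jet_chain_rule ::
    "(real ^ 'n) set \<Rightarrow> nat \<Rightarrow> ('n::finite jet \<Rightarrow> real) \<Rightarrow> (nat \<Rightarrow> 'n \<Rightarrow> 'n jet \<Rightarrow> real) \<Rightarrow> bool" where
  "jet_chain_rule V m f D \<longleftrightarrow>
     (\<forall>Y Y' t. (\<forall>\<alpha>\<le>m. ((\<lambda>s. Y s \<alpha>) has_vector_derivative Y' \<alpha>) (at t)) \<and> Y t 0 \<in> V \<longrightarrow>
        ((\<lambda>s. f (Y s)) has_real_derivative (\<Sum>\<alpha>\<le>m. \<Sum>i\<in>UNIV. D \<alpha> i (Y t) * Y' \<alpha> $ i)) (at t))"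

lemma jet_chain_ruleD:
  assumes "jet_chain_rule V m f D"
    and "\<And>\<alpha>. \<alpha> \<le> m \<Longrightarrow> ((\<lambda>s. Y s \<alpha>) has_vector_derivative Y' \<alpha>) (at t)" "Y t 0 \<in> V"
  shows "((\<lambda>s. f (Y s)) has_real_derivative (\<Sum>\<alpha>\<le>m. \<Sum>i\<in>UNIV. D \<alpha> i (Y t) * Y' \<alpha> $ i)) (at t)"
  using assms unfolding jet_chain_rule_def by blast

lemma linear_eq_sum_axis:
  fixes L :: "real ^ 'n \<Rightarrow> real"
  assumes "linear L"
  shows "L v = (\<Sum>i\<in>UNIV. L (axis i 1) * v $ i)"
proof -
  have "L v = L (\<Sum>i\<in>UNIV. v $ i *\<^sub>R axis i 1)"
    using basis_expansion[of v] by (simp add: scalar_mult_eq_scaleR)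
  also have "\<dots> = (\<Sum>i\<in>UNIV. L (axis i 1) * v $ i)"
    by (simp add: linear_sum[OF assms] linear_cmul[OF assms] mult.commute)
  finally show ?thesis .
qed

lemma smooth_on_frechet_derivative:
  assumes "smooth_on V h" "e \<in> Basis"
  shows "smooth_on V (\<lambda>x. frechet_derivative h (at x) e)"
  using assms unfolding smooth_on_def by (metis Ck_on.simps(2))

lemma smooth_on_differentiable: "smooth_on V h \<Longrightarrow> x \<in> V \<Longrightarrow> h differentiable (at x)"
  unfolding smooth_on_def by (metis Ck_on.simps(2))

text \<open>By induction on the generation of \<open>f\<close>, using the differentiation rules for sums, products and
  reciprocals. Existence of some gradient is the statement that passes through the induction;
  afterwards \<open>jet_chain_rule_jet_pd\<close> identifies it with the partial derivatives.\<close>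

lemma smooth_jet_fun_gradient_exists:
  assumes "open V" "smooth_jet_fun V m f"
  shows "\<exists>D. jet_chain_rule V m f D \<and> (\<forall>\<alpha> i. smooth_jet_fun V m (D \<alpha> i))"
  using assms(2)
proof induction
  case (base h)
  let ?D = "\<lambda>\<alpha> i y. if \<alpha> = 0 then frechet_derivative h (at (y 0)) (axis i 1) else 0"
  have "jet_chain_rule V m (\<lambda>y. h (y 0)) ?D"
    unfolding jet_chain_rule_def
  proof safe
    fix Y :: "real \<Rightarrow> 'a jet" and Y' t
    assume Y: "\<forall>\<alpha>\<le>m. ((\<lambda>s. Y s \<alpha>) has_vector_derivative Y' \<alpha>) (at t)" and V: "Y t 0 \<in> V"
    let ?h = "frechet_derivative h (at (Y t 0))"
    have h: "(h has_derivative ?h) (at (Y t 0))"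
      using smooth_on_differentiable[OF base V] by (simp add: frechet_derivative_works)
    have "((\<lambda>s. h (Y s 0)) has_vector_derivative ?h (Y' 0)) (at t)"
      using vector_derivative_diff_chain_within[of "\<lambda>s. Y s 0" "Y' 0" t UNIV h ?h]
        Y has_derivative_at_withinI[OF h] by (auto simp: o_def)
    moreover have "?h (Y' 0) = (\<Sum>i\<in>UNIV. ?h (axis i 1) * Y' 0 $ i)"
      using h has_derivative_linear linear_eq_sum_axis by blast
    moreover have "(\<Sum>\<alpha>\<le>m. \<Sum>i\<in>UNIV. ?D \<alpha> i (Y t) * Y' \<alpha> $ i) =
        (\<Sum>\<alpha>\<le>m. if \<alpha> = 0 then \<Sum>i\<in>UNIV. ?h (axis i 1) * Y' 0 $ i else 0)"
      by (intro sum.cong) auto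
    ultimately show "((\<lambda>s. h (Y s 0)) has_real_derivative
        (\<Sum>\<alpha>\<le>m. \<Sum>i\<in>UNIV. ?D \<alpha> i (Y t) * Y' \<alpha> $ i)) (at t)"
      by (simp add: has_real_derivative_iff_has_vector_derivative)
  qed
  moreover have "smooth_jet_fun V m (?D \<alpha> i)" for \<alpha> i
  proof (cases "\<alpha> = 0")
    case True
    have "axis i 1 \<in> (Basis :: (real ^ 'a) set)" by (simp add: axis_in_Basis_iff)
    from smooth_jet_fun.base[OF smooth_on_frechet_derivative[OF base this], of m]
    show ?thesis using True by simp
  qed (simp add: smooth_jet_fun_const)
  ultimately show ?case by blast
next
  case (coord \<beta> j)
  let ?D = "\<lambda>\<alpha> i y. if \<alpha> = \<beta> \<and> i = j then 1 else 0 :: real"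
  have "(\<Sum>\<alpha>\<le>m. \<Sum>i\<in>UNIV. ?D \<alpha> i y * Y' \<alpha> $ i) = Y' \<beta> $ j" for y and Y' :: "'a jet"
  proof -
    have "(\<Sum>\<alpha>\<le>m. \<Sum>i\<in>UNIV. ?D \<alpha> i y * Y' \<alpha> $ i) = (\<Sum>\<alpha>\<le>m. if \<alpha> = \<beta> then Y' \<beta> $ j else 0)"
      by (intro sum.cong) (auto simp: if_distrib[of "\<lambda>c. c * _"] cong: if_cong)
    then show ?thesis using coord by simp
  qed
  then have "jet_chain_rule V m (\<lambda>y. y \<beta> $ j) ?D"
    using coord unfolding jet_chain_rule_def has_real_derivative_iff_has_vector_derivative
    by (auto intro!: bounded_linear.has_vector_derivative[OF bounded_linear_vec_nth])
  then show ?case by (auto intro!: exI[of _ ?D] smooth_jet_fun_const)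
next
  case (add f g)
  then obtain D E where "jet_chain_rule V m f D" "jet_chain_rule V m g E"
    and DE: "\<And>\<alpha> i. smooth_jet_fun V m (D \<alpha> i)" "\<And>\<alpha> i. smooth_jet_fun V m (E \<alpha> i)" by metis
  then have "jet_chain_rule V m (\<lambda>y. f y + g y) (\<lambda>\<alpha> i y. D \<alpha> i y + E \<alpha> i y)"
    by (auto simp: jet_chain_rule_def distrib_right sum.distrib intro!: DERIV_add)
  moreover have "smooth_jet_fun V m (\<lambda>y. D \<alpha> i y + E \<alpha> i y)" for \<alpha> i
    by (intro smooth_jet_fun.add DE)
  ultimately show ?case by (intro exI conjI allI)
next
  case (mult f g)
  then obtain D E where D: "jet_chain_rule V m f D" and E: "jet_chain_rule V m g E"
    and DE: "\<And>\<alpha> i. smooth_jet_fun V m (D \<alpha> i)" "\<And>\<alpha> i. smooth_jet_fun V m (E \<alpha> i)" by metis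
  have "jet_chain_rule V m (\<lambda>y. f y * g y) (\<lambda>\<alpha> i y. D \<alpha> i y * g y + E \<alpha> i y * f y)"
    unfolding jet_chain_rule_def
  proof safe
    fix Y :: "real \<Rightarrow> 'a jet" and Y' t
    assume Y: "\<forall>\<alpha>\<le>m. ((\<lambda>s. Y s \<alpha>) has_vector_derivative Y' \<alpha>) (at t)" and V: "Y t 0 \<in> V"
    show "((\<lambda>s. f (Y s) * g (Y s)) has_real_derivative
        (\<Sum>\<alpha>\<le>m. \<Sum>i\<in>UNIV. (D \<alpha> i (Y t) * g (Y t) + E \<alpha> i (Y t) * f (Y t)) * Y' \<alpha> $ i)) (at t)"
      using Y V
      by (auto intro!: DERIV_cong[OF DERIV_mult[OF jet_chain_ruleD[OF D] jet_chain_ruleD[OF E]]]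
          simp: sum_distrib_left distrib_left sum.distrib ac_simps)
  qed
  moreover have "smooth_jet_fun V m (\<lambda>y. D \<alpha> i y * g y + E \<alpha> i y * f y)" for \<alpha> i
    by (intro smooth_jet_fun.add smooth_jet_fun.mult DE mult.hyps)
  ultimately show ?case by (intro exI conjI allI)
next
  case (inverse f)
  then obtain D where D: "jet_chain_rule V m f D"
    and sD: "\<And>\<alpha> i. smooth_jet_fun V m (D \<alpha> i)" by metis
  have "jet_chain_rule V m (\<lambda>y. inverse (f y))
      (\<lambda>\<alpha> i y. - (inverse (f y) * inverse (f y) * D \<alpha> i y))"
    unfolding jet_chain_rule_def
  proof safe
    fix Y :: "real \<Rightarrow> 'a jet" and Y' t
    assume Y: "\<forall>\<alpha>\<le>m. ((\<lambda>s. Y s \<alpha>) has_vector_derivative Y' \<alpha>) (at t)" and V: "Y t 0 \<in> V"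
    show "((\<lambda>s. inverse (f (Y s))) has_real_derivative
        (\<Sum>\<alpha>\<le>m. \<Sum>i\<in>UNIV. - (inverse (f (Y t)) * inverse (f (Y t)) * D \<alpha> i (Y t)) * Y' \<alpha> $ i)) (at t)"
      using Y V inverse(2)
      by (auto intro!: DERIV_cong[OF DERIV_inverse'[OF jet_chain_ruleD[OF D]]]
          simp: sum_distrib_left sum_distrib_right sum_negf ac_simps)
  qed
  moreover have "smooth_jet_fun V m (\<lambda>y. inverse (f y))"
    using inverse(1,2) by (rule smooth_jet_fun.inverse)
  then have "smooth_jet_fun V m (\<lambda>y. - (inverse (f y) * inverse (f y) * D \<alpha> i y))" for \<alpha> i
    using sD by (intro smooth_jet_fun_minus smooth_jet_fun.mult)
  ultimately show ?case by (intro exI conjI allI)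
next
  case (cong f g)
  then obtain D where D: "jet_chain_rule V m f D"
    and sD: "\<And>\<alpha> i. smooth_jet_fun V m (D \<alpha> i)" by metis
  have "jet_chain_rule V m g D"
    unfolding jet_chain_rule_def
  proof safe
    fix Y :: "real \<Rightarrow> 'a jet" and Y' t
    assume Y: "\<forall>\<alpha>\<le>m. ((\<lambda>s. Y s \<alpha>) has_vector_derivative Y' \<alpha>) (at t)" and V: "Y t 0 \<in> V"
    have "isCont (\<lambda>s. Y s 0) t"
      using Y has_vector_derivative_continuous by blast
    then have "eventually (\<lambda>s. Y s 0 \<in> V) (nhds t)"
      using V \<open>open V\<close> by (auto simp: continuous_at_open eventually_nhds)
    then have eq: "eventually (\<lambda>s. f (Y s) = g (Y s)) (nhds t)"
      by eventually_elim (use cong(2) in auto)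
    have "((\<lambda>s. f (Y s)) has_real_derivative (\<Sum>\<alpha>\<le>m. \<Sum>i\<in>UNIV. D \<alpha> i (Y t) * Y' \<alpha> $ i)) (at t)"
      using Y V by (intro jet_chain_ruleD[OF D]) auto
    then show "((\<lambda>s. g (Y s)) has_real_derivative (\<Sum>\<alpha>\<le>m. \<Sum>i\<in>UNIV. D \<alpha> i (Y t) * Y' \<alpha> $ i)) (at t)"
      by (rule iffD1[OF DERIV_cong_ev[OF refl eq refl]])
  qed
  then show ?case using sD by blast
qed

text \<open>A partial derivative is the derivative along a line in a single coordinate, to which the chain
  rule applies.\<close>

lemma jet_chain_rule_jet_pd:
  fixes f :: "'n::finite jet \<Rightarrow> real"
  assumes "jet_chain_rule V m f D" "y 0 \<in> V"
  shows "jet_pd \<alpha> i f y = (if \<alpha> \<le> m then D \<alpha> i y else 0)"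
proof -
  let ?Y = "\<lambda>s. y(\<alpha> := y \<alpha> + s *\<^sub>R axis i 1)"
  let ?Y' = "\<lambda>\<beta>. if \<beta> = \<alpha> then axis i 1 else (0 :: real ^ 'n)"
  have "((\<lambda>s. f (?Y s)) has_real_derivative (\<Sum>\<beta>\<le>m. \<Sum>j\<in>UNIV. D \<beta> j (?Y 0) * ?Y' \<beta> $ j)) (at 0)"
  proof (rule jet_chain_ruleD[OF assms(1)])
    fix \<beta>
    show "((\<lambda>s. ?Y s \<beta>) has_vector_derivative ?Y' \<beta>) (at 0)"
      by (auto intro!: derivative_eq_intros)
  qed (use assms in auto)
  moreover have "(\<Sum>\<beta>\<le>m. \<Sum>j\<in>UNIV. D \<beta> j (?Y 0) * ?Y' \<beta> $ j) =
      (\<Sum>\<beta>\<le>m. if \<beta> = \<alpha> then D \<alpha> i y else 0)"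
    by (intro sum.cong) (auto simp: axis_def if_distrib cong: if_cong)
  ultimately show ?thesis
    by (simp add: jet_pd_def DERIV_imp_deriv)
qed

lemma smooth_jet_fun_chain_rule:
  assumes "open V" "smooth_jet_fun V m f"
  shows "jet_chain_rule V m f (\<lambda>\<alpha> i. jet_pd \<alpha> i f)"
proof -
  obtain D where D: "jet_chain_rule V m f D"
    using smooth_jet_fun_gradient_exists[OF assms] by blast
  show ?thesis
    using D unfolding jet_chain_rule_def by (simp add: jet_chain_rule_jet_pd[OF D])
qed

lemma smooth_jet_fun_jet_pd:
  assumes "open V" "smooth_jet_fun V m f"
  shows "smooth_jet_fun V m (jet_pd \<alpha> i f)"
proof -
  obtain D where D: "jet_chain_rule V m f D" and sD: "smooth_jet_fun V m (D \<alpha> i)"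
    using smooth_jet_fun_gradient_exists[OF assms] by blast
  have "smooth_jet_fun V m (\<lambda>y. if \<alpha> \<le> m then D \<alpha> i y else 0)"
    using sD by (cases "\<alpha> \<le> m") (simp_all add: smooth_jet_fun_const)
  then show ?thesis
    by (rule smooth_jet_fun.cong) (simp add: jet_chain_rule_jet_pd[OF D])
qed

lemma jet_pd_eq_0:
  assumes "open V" "smooth_jet_fun V m f" "m < \<alpha>" "y 0 \<in> V"
  shows "jet_pd \<alpha> i f y = 0"
  using jet_chain_rule_jet_pd[OF smooth_jet_fun_chain_rule[OF assms(1,2)], where y = y and \<alpha> = \<alpha> and i = i]
    assms(3,4)
  by simp

text \<open>The coefficient of \<open>\<partial>/\<partial>y\<^sup>(\<^sup>\<alpha>\<^sup>-\<^sup>1\<^sup>)\<close> in \<open>\<Gamma>\<close> has order \<open>\<alpha>\<close>, and the terms with \<open>\<alpha> - 1 > m\<close> vanish.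
  Hence \<open>\<Gamma>\<close> raises the order by only one, for every \<open>k\<close>.\<close>

lemma smooth_jet_fun_Gamma_op:
  assumes "open V" "smooth_jet_fun V m f"
  shows "smooth_jet_fun V (Suc m) (Gamma_op k f)"
  unfolding Gamma_op_def
proof (intro smooth_jet_fun_sum)
  fix \<alpha> i assume "\<alpha> \<in> {1..k}"
  show "smooth_jet_fun V (Suc m) (\<lambda>y. real \<alpha> * y \<alpha> $ i * jet_pd (\<alpha> - 1) i f y)"
  proof (cases "\<alpha> \<le> Suc m")
    case True
    then show ?thesis
      using smooth_jet_fun_mono[OF smooth_jet_fun_jet_pd[OF assms]]
      by (intro smooth_jet_fun_intros) auto
  next
    case False
    then show ?thesis
      by (intro smooth_jet_fun.cong[OF smooth_jet_fun_const[of V "Suc m" 0]])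
        (simp add: jet_pd_eq_0[OF assms])
  qed
qed

section \<open>The prolonged Lagrangian\<close>

lemma smooth_on_component:
  fixes \<gamma> :: "real ^ 'n \<Rightarrow> real ^ 'n ^ 'n"
  assumes "open V" "smooth_on V \<gamma>"
  shows "smooth_on V (\<lambda>x. \<gamma> x $ i $ j)"
  using assms unfolding smooth_on_def
  by (auto intro!: Ck_on_bounded_linear[OF _ bounded_linear_vec_nth])

lemma matrix_inv_mult:
  assumes "invertible G"
  shows "G ** matrix_inv G = mat 1" "matrix_inv G ** G = mat 1"
  using someI_ex[OF assms[unfolded invertible_def]] unfolding matrix_inv_def by auto

text \<open>By Cramer's rule an entry of the inverse is a quotient of two determinants, which are
  polynomials in the entries of the matrix.\<close>

lemma smooth_jet_fun_matrix_inv: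
  fixes \<gamma> :: "real ^ 'n \<Rightarrow> real ^ 'n ^ 'n"
  assumes "\<And>i j. smooth_jet_fun V m (\<lambda>y. \<gamma> (y 0) $ i $ j)" "\<And>x. x \<in> V \<Longrightarrow> invertible (\<gamma> x)"
  shows "smooth_jet_fun V m (\<lambda>y. matrix_inv (\<gamma> (y 0)) $ i $ j)"
proof -
  \<comment> \<open>the matrix \<open>\<gamma>\<close> with column \<open>i\<close> replaced by the \<open>j\<close>-th unit vector\<close>
  define B where "B y = (\<chi> a b. if b = i then axis j 1 $ a else \<gamma> (y 0) $ a $ b)" for y :: "'n jet"
  have det: "smooth_jet_fun V m (\<lambda>y. det (M y))"
    if "\<And>a b. smooth_jet_fun V m (\<lambda>y. M y $ a $ b)" for M :: "'n jet \<Rightarrow> real ^ 'n ^ 'n"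
    unfolding det_def by (intro smooth_jet_fun_intros that)
  have "smooth_jet_fun V m (\<lambda>y. det (B y) * inverse (det (\<gamma> (y 0))))"
  proof (intro smooth_jet_fun.mult smooth_jet_fun.inverse det)
    fix a b
    show "smooth_jet_fun V m (\<lambda>y. B y $ a $ b)"
      using assms(1) smooth_jet_fun_const by (cases "b = i") (auto simp: B_def)
  qed (use assms in \<open>auto simp: invertible_det_nz\<close>)
  then show ?thesis
  proof (rule smooth_jet_fun.cong)
    fix y :: "'n jet" assume "y 0 \<in> V"
    then have inv: "invertible (\<gamma> (y 0))" by (rule assms)
    then have "\<gamma> (y 0) *v (matrix_inv (\<gamma> (y 0)) *v axis j 1) = axis j 1"
      by (simp add: matrix_vector_mul_assoc matrix_inv_mult)
    then have "matrix_inv (\<gamma> (y 0)) *v axis j 1 = (\<chi> k. det (\<chi> a b. if b = k then axis j 1 $ a else \<gamma> (y 0) $ a $ b) / det (\<gamma> (y 0)))"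
      using inv by (simp add: cramer invertible_det_nz)
    then have "(matrix_inv (\<gamma> (y 0)) *v axis j 1) $ i = det (B y) / det (\<gamma> (y 0))"
      by (simp add: B_def)
    then show "det (B y) * inverse (det (\<gamma> (y 0))) = matrix_inv (\<gamma> (y 0)) $ i $ j"
      by (simp add: matrix_vector_mul_component inner_axis divide_inverse)
  qed
qed

lemma smooth_jet_fun_christoffel:
  assumes "open V" "smooth_on V \<gamma>" "\<And>x. x \<in> V \<Longrightarrow> invertible (\<gamma> x)"
  shows "smooth_jet_fun V m (\<lambda>y. christoffel \<gamma> i j l (y 0))"
proof -
  have g: "smooth_jet_fun V m (\<lambda>y. \<gamma> (y 0) $ i $ j)" for i j
    by (rule smooth_jet_fun.base) (rule smooth_on_component[OF assms(1,2)])
  \<comment> \<open>a partial derivative of the metric is a partial derivative of a function of jets\<close>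
  have "jet_pd 0 l (\<lambda>y. \<gamma> (y 0) $ i $ j) = (\<lambda>y. metric_pd \<gamma> i j l (y 0))" for i j l
    by (simp add: jet_pd_def metric_pd_def fun_eq_iff)
  then have "smooth_jet_fun V m (\<lambda>y. metric_pd \<gamma> i j l (y 0))" for i j l
    using smooth_jet_fun_jet_pd[OF assms(1) g] by metis
  then show ?thesis
    unfolding christoffel_def
    by (intro smooth_jet_fun_intros smooth_jet_fun_matrix_inv g assms(3))
qed

lemma smooth_jet_fun_dual_coeff:
  assumes "open V" "smooth_on V \<gamma>" "\<And>x. x \<in> V \<Longrightarrow> invertible (\<gamma> x)"
  shows "smooth_jet_fun V \<alpha> (dual_coeff k \<gamma> \<alpha> i j)"
proof (induction \<alpha> arbitrary: i j)
  case 0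
  then show ?case by (simp add: smooth_jet_fun_const)
next
  case (Suc \<alpha>)
  have M1: "smooth_jet_fun V (Suc 0) (dual_coeff k \<gamma> (Suc 0) i j)" for i j
  proof -
    have "dual_coeff k \<gamma> (Suc 0) i j = (\<lambda>y. \<Sum>m\<in>UNIV. christoffel \<gamma> i j m (y 0) * y 1 $ m)"
      by (rule ext) simp
    then show ?thesis
      by (auto intro!: smooth_jet_fun_intros smooth_jet_fun_christoffel assms)
  qed
  show ?case
  proof (cases \<alpha>)
    case 0
    then show ?thesis using M1 by (simp only:)
  next
    case (Suc \<beta>)
    let ?M = "dual_coeff k \<gamma> (Suc \<beta>)"
    have M: "smooth_jet_fun V (Suc \<beta>) (?M i j)" for i j
      using Suc.IH Suc by simp
    have "dual_coeff k \<gamma> (Suc \<alpha>) i j = (\<lambda>y. 1 / real (Suc (Suc \<beta>)) * (Gamma_op k (?M i j) y +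
        (\<Sum>m\<in>UNIV. dual_coeff k \<gamma> (Suc 0) i m y * ?M m j y)))"
      unfolding Suc by (rule ext) (rule dual_coeff.simps(3))
    moreover have "smooth_jet_fun V (Suc \<alpha>) (?M i j)" "smooth_jet_fun V (Suc \<alpha>) (Gamma_op k (?M i j))"
      "smooth_jet_fun V (Suc \<alpha>) (dual_coeff k \<gamma> (Suc 0) i j)" for i j
      using smooth_jet_fun_mono[OF M] smooth_jet_fun_Gamma_op[OF assms(1) M] smooth_jet_fun_mono[OF M1] Suc
      by simp_all
    ultimately show ?thesis
      by (simp only:) (intro smooth_jet_fun_intros)
  qed
qed

text \<open>The part of \<open>z\<^sup>(\<^sup>k\<^sup>)\<close> of order below \<open>k\<close>; what remains is \<open>y\<^sup>(\<^sup>k\<^sup>)\<close>.\<close>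

definition liouville_rest ::
    "nat \<Rightarrow> (real ^ 'n \<Rightarrow> real ^ 'n ^ 'n) \<Rightarrow> 'n \<Rightarrow> 'n::finite jet \<Rightarrow> real" where
  "liouville_rest k \<gamma> i y = 1 / real k *
     (\<Sum>\<alpha>=1..<k. real (k - \<alpha>) * (\<Sum>m\<in>UNIV. dual_coeff k \<gamma> \<alpha> i m y * y (k - \<alpha>) $ m))"

lemma liouville_eq: "k \<ge> 1 \<Longrightarrow> liouville k \<gamma> i y = y k $ i + liouville_rest k \<gamma> i y"
  by (simp add: liouville_def liouville_rest_def distrib_left)

lemma smooth_jet_fun_liouville_rest:
  assumes "open V" "smooth_on V \<gamma>" "\<And>x. x \<in> V \<Longrightarrow> invertible (\<gamma> x)"
  shows "smooth_jet_fun V (k - 1) (liouville_rest k \<gamma> i)"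
  unfolding liouville_rest_def
  by (intro smooth_jet_fun_intros smooth_jet_fun_mono[OF smooth_jet_fun_dual_coeff[OF assms]]) auto

lemma smooth_jet_fun_liouville:
  assumes "open V" "smooth_on V \<gamma>" "\<And>x. x \<in> V \<Longrightarrow> invertible (\<gamma> x)" "k \<ge> 1"
  shows "smooth_jet_fun V k (liouville k \<gamma> i)"
  unfolding liouville_eq[OF assms(4), abs_def]
  by (intro smooth_jet_fun_intros smooth_jet_fun_mono[OF smooth_jet_fun_liouville_rest[OF assms(1-3)]])
    auto

lemma liouville_has_top_derivative:
  fixes \<gamma> :: "real ^ 'n \<Rightarrow> real ^ 'n ^ 'n"
  assumes "open V" "smooth_on V \<gamma>" "\<And>x. x \<in> V \<Longrightarrow> invertible (\<gamma> x)" "k \<ge> 1" "y 0 \<in> V"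
  shows "((\<lambda>s. liouville k \<gamma> i (y(k := y k + s *\<^sub>R axis j 1))) has_real_derivative
      (if i = j then 1 else 0)) (at 0)"
proof -
  let ?Y = "\<lambda>s. y(k := y k + s *\<^sub>R axis j 1)"
  have "((\<lambda>s. liouville_rest k \<gamma> i (?Y s)) has_real_derivative
      (\<Sum>\<alpha>\<le>k - 1. \<Sum>l\<in>UNIV. jet_pd \<alpha> l (liouville_rest k \<gamma> i) (?Y 0) * (0 :: real ^ 'n) $ l)) (at 0)"
  proof (rule jet_chain_ruleD[OF smooth_jet_fun_chain_rule[OF assms(1)
          smooth_jet_fun_liouville_rest[OF assms(1-3)]]])
    fix \<alpha> assume "\<alpha> \<le> k - 1"
    then have "\<alpha> \<noteq> k" using assms(4) by simp
    then show "((\<lambda>s. ?Y s \<alpha>) has_vector_derivative 0) (at 0)" by simp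
  qed (use assms(4,5) in auto)
  then have rest: "((\<lambda>s. liouville_rest k \<gamma> i (?Y s)) has_real_derivative 0) (at 0)"
    by simp
  have "((\<lambda>s. (y k $ i + s * axis j 1 $ i) + liouville_rest k \<gamma> i (?Y s)) has_real_derivative
      axis j 1 $ i + 0) (at 0)"
    by (intro DERIV_add rest) (auto intro!: derivative_eq_intros)
  then show ?thesis
    by (simp add: liouville_eq[OF assms(4)] axis_def)
qed

text \<open>The Lagrangian is a quadratic form in \<open>z\<^sup>(\<^sup>k\<^sup>)\<close> with coefficients depending on \<open>x\<close> alone, and
  \<open>k \<ge> 1\<close> ensures that moving \<open>y\<^sup>(\<^sup>k\<^sup>)\<close> leaves \<open>x\<close> in place. The two terms of the product rule agree
  because the metric is symmetric.\<close>

lemma jet_pd_lagrangian: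
  fixes \<gamma> :: "real ^ 'n \<Rightarrow> real ^ 'n ^ 'n"
  assumes "open V" "smooth_on V \<gamma>" "\<And>x. x \<in> V \<Longrightarrow> invertible (\<gamma> x)" "k \<ge> 1" "y 0 \<in> V"
    and "transpose (\<gamma> (y 0)) = \<gamma> (y 0)"
  shows "jet_pd k i (lagrangian k \<gamma>) y = 2 * (\<Sum>j\<in>UNIV. \<gamma> (y 0) $ i $ j * liouville k \<gamma> j y)"
proof -
  let ?Y = "\<lambda>s. y(k := y k + s *\<^sub>R axis i 1)"
  let ?g = "\<gamma> (y 0)" and ?z = "\<lambda>a. liouville k \<gamma> a y"
  let ?d = "\<lambda>a. if a = i then 1 else 0 :: real"
  have sym: "?g $ a $ b = ?g $ b $ a" for a b
    using assms(6) by (metis transpose_def vec_lambda_beta)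
  note [derivative_intros] = liouville_has_top_derivative[where \<gamma> = \<gamma> and y = y, OF assms(1-5), of _ i]
  have "((\<lambda>s. lagrangian k \<gamma> (?Y s)) has_real_derivative
      (\<Sum>a\<in>UNIV. \<Sum>b\<in>UNIV. ?g $ a $ b * ?d a * ?z b + ?g $ a $ b * ?d b * ?z a)) (at 0)"
    unfolding lagrangian_def
    using assms(4) by (auto intro!: derivative_eq_intros sum.cong)
  moreover have "(\<Sum>a\<in>UNIV. \<Sum>b\<in>UNIV. ?g $ a $ b * ?d a * ?z b + ?g $ a $ b * ?d b * ?z a) =
      (\<Sum>b\<in>UNIV. ?g $ i $ b * ?z b) + (\<Sum>a\<in>UNIV. ?g $ a $ i * ?z a)"
  proof -
    have 1: "(\<Sum>b\<in>UNIV. ?g $ a $ b * ?d a * ?z b) = (if a = i then \<Sum>b\<in>UNIV. ?g $ i $ b * ?z b else 0)" for a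
      by auto
    have 2: "(\<Sum>b\<in>UNIV. ?g $ a $ b * ?d b * ?z a) = ?g $ a $ i * ?z a" for a
      by (simp add: if_distrib[of "\<lambda>c. _ * c"] if_distrib[of "\<lambda>c. c * _"] cong: if_cong)
    show ?thesis by (simp add: sum.distrib 1 2)
  qed
  ultimately show ?thesis
    by (simp add: jet_pd_def DERIV_imp_deriv sym[of _ i])
qed

section \<open>The equations of motion\<close>

lemma jet_has_vector_derivative:
  fixes x :: "real \<Rightarrow> real ^ 'n"
  assumes "open S" "Ck_on (Suc k) S x" "t \<in> S" "\<alpha> \<le> k"
  shows "((\<lambda>s. jet k x s \<alpha>) has_vector_derivative
      (1 / fact \<alpha>) *\<^sub>R higher_deriv (Suc \<alpha>) x t) (at t)"
  using higher_deriv_has_vector_derivative[OF assms(1,2), of \<alpha> t] assms(3,4)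
  by (auto simp: jet_def intro!: derivative_eq_intros)

text \<open>The coefficients of \<open>\<Gamma>\<close> are the derivatives of the jet coordinates of order below \<open>k\<close> along the
  curve. The derivative of \<open>y\<^sup>(\<^sup>k\<^sup>)\<close> is not a function of the \<open>k\<close>-jet and gives the extra term.\<close>

lemma deriv_along_jet:
  fixes x :: "real \<Rightarrow> real ^ 'n"
  assumes "open V" "smooth_jet_fun V k f" "open S" "Ck_on (Suc k) S x" "t \<in> S" "x t \<in> V"
  shows "((\<lambda>s. f (jet k x s)) has_real_derivative
      Gamma_op k f (jet k x t) +
      1 / fact k * (\<Sum>j\<in>UNIV. jet_pd k j f (jet k x t) * higher_deriv (Suc k) x t $ j)) (at t)"
proof -
  let ?y = "jet k x t"
  let ?v = "\<lambda>\<alpha>. (1 / fact \<alpha>) *\<^sub>R higher_deriv (Suc \<alpha>) x t"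
  have "((\<lambda>s. f (jet k x s)) has_real_derivative
      (\<Sum>\<alpha>\<le>k. \<Sum>i\<in>UNIV. jet_pd \<alpha> i f ?y * ?v \<alpha> $ i)) (at t)"
    by (rule jet_chain_ruleD[OF smooth_jet_fun_chain_rule[OF assms(1,2)]])
      (use assms jet_has_vector_derivative[OF assms(3-5)] in \<open>auto simp: jet_def higher_deriv_def\<close>)
  moreover have "Gamma_op k f ?y = (\<Sum>\<alpha><k. \<Sum>i\<in>UNIV. jet_pd \<alpha> i f ?y * ?v \<alpha> $ i)"
  proof -
    have "?v \<alpha> = real (Suc \<alpha>) *\<^sub>R ?y (Suc \<alpha>)" if "\<alpha> < k" for \<alpha>
      using that by (simp add: jet_def del: of_nat_Suc)
    then have "(\<Sum>\<alpha><k. \<Sum>i\<in>UNIV. jet_pd \<alpha> i f ?y * ?v \<alpha> $ i) =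
        (\<Sum>\<alpha><k. \<Sum>i\<in>UNIV. real (Suc \<alpha>) * ?y (Suc \<alpha>) $ i * jet_pd \<alpha> i f ?y)"
      by (intro sum.cong refl) (simp add: ac_simps del: of_nat_Suc)
    then show ?thesis
      unfolding Gamma_op_def by (simp add: sum.atLeast1_atMost_eq)
  qed
  moreover have "(\<Sum>i\<in>UNIV. jet_pd k i f ?y * ?v k $ i) =
      1 / fact k * (\<Sum>j\<in>UNIV. jet_pd k j f ?y * higher_deriv (Suc k) x t $ j)"
    by (simp add: sum_divide_distrib)
  ultimately show ?thesis
    by (simp add: lessThan_Suc_atMost[symmetric])
qed

lemma lagrange_expression_along_jet:
  fixes \<gamma> :: "real ^ 'n \<Rightarrow> real ^ 'n ^ 'n" and x :: "real \<Rightarrow> real ^ 'n"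
  assumes "open V" "smooth_on V \<gamma>" "\<And>x. x \<in> V \<Longrightarrow> invertible (\<gamma> x)"
    and "\<And>x. x \<in> V \<Longrightarrow> transpose (\<gamma> x) = \<gamma> x" "k \<ge> 1"
    and "open S" "Ck_on (Suc k) S x" "t \<in> S" "x t \<in> V"
  shows "deriv (\<lambda>s. jet_pd k i (lagrangian k \<gamma>) (jet k x s)) t =
      Gamma_op k (jet_pd k i (lagrangian k \<gamma>)) (jet k x t) +
      2 / fact k * (\<gamma> (x t) *v higher_deriv (Suc k) x t) $ i"
proof -
  let ?p = "jet_pd k i (lagrangian k \<gamma>)" and ?y = "jet k x t"
  have y0: "?y 0 = x t" by (simp add: jet_def higher_deriv_def)
  have p: "?p y = 2 * (\<Sum>j\<in>UNIV. \<gamma> (y 0) $ i $ j * liouville k \<gamma> j y)" if "y 0 \<in> V" for y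
    by (rule jet_pd_lagrangian[where \<gamma> = \<gamma>, OF assms(1,2,3,5)]) (use assms(4) that in auto)
  have "smooth_jet_fun V k (\<lambda>y. 2 * (\<Sum>j\<in>UNIV. \<gamma> (y 0) $ i $ j * liouville k \<gamma> j y))"
    by (intro smooth_jet_fun_intros smooth_jet_fun_liouville assms
        smooth_jet_fun.base[OF smooth_on_component])
  then have smooth: "smooth_jet_fun V k ?p"
    by (rule smooth_jet_fun.cong) (simp add: p)
  have top: "jet_pd k j ?p ?y = 2 * \<gamma> (x t) $ i $ j" for j
  proof -
    let ?Y = "\<lambda>s. ?y(k := ?y k + s *\<^sub>R axis j 1)"
    have yV: "?y 0 \<in> V" using y0 assms(9) by simp
    note [derivative_intros] = liouville_has_top_derivative[where \<gamma> = \<gamma> and y = ?y, OF assms(1) assms(2) assms(3) assms(5) yV, of _ j]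
    have "((\<lambda>s. 2 * (\<Sum>l\<in>UNIV. \<gamma> (x t) $ i $ l * liouville k \<gamma> l (?Y s))) has_real_derivative
        2 * (\<Sum>l\<in>UNIV. \<gamma> (x t) $ i $ l * (if l = j then 1 else 0))) (at 0)"
      by (auto intro!: derivative_eq_intros sum.cong)
    moreover have "?p (?Y s) = 2 * (\<Sum>l\<in>UNIV. \<gamma> (x t) $ i $ l * liouville k \<gamma> l (?Y s))" for s
      using p[of "?Y s"] assms(5,9) y0 by simp
    ultimately have "((\<lambda>s. ?p (?Y s)) has_real_derivative 2 * \<gamma> (x t) $ i $ j) (at 0)"
      by (simp add: if_distrib cong: if_cong)
    then show ?thesis
      by (subst jet_pd_def) (rule DERIV_imp_deriv)
  qed
  show ?thesis
    using DERIV_imp_deriv[OF deriv_along_jet[OF assms(1) smooth assms(6-9)]]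
    by (simp add: top matrix_vector_mult_def sum_distrib_left ac_simps sum_divide_distrib)
qed

lemma solve_for_highest_derivative:
  fixes G :: "real ^ 'n ^ 'n"
  assumes "invertible G" "c \<noteq> 0"
  shows "a + (1 / c) *\<^sub>R (G *v q) = G *v f \<longleftrightarrow> q + c *\<^sub>R (matrix_inv G *v a) = c *\<^sub>R f"
proof -
  have inv: "matrix_inv G *v (G *v v) = v" "G *v (matrix_inv G *v v) = v" for v
    using assms(1) by (simp_all add: matrix_vector_mul_assoc matrix_inv_mult)
  have "a + (1 / c) *\<^sub>R (G *v q) = G *v f \<longleftrightarrow>
      matrix_inv G *v (a + (1 / c) *\<^sub>R (G *v q)) = matrix_inv G *v (G *v f)"
    by (metis inv(2))
  also have "\<dots> \<longleftrightarrow> matrix_inv G *v a + (1 / c) *\<^sub>R q = f"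
    by (simp add: matrix_vector_right_distrib matrix_vector_mult_scaleR inv)
  also have "\<dots> \<longleftrightarrow> c *\<^sub>R (matrix_inv G *v a + (1 / c) *\<^sub>R q) = c *\<^sub>R f"
    using assms(2) by simp
  finally show ?thesis
    using assms(2) by (simp add: scaleR_add_right add.commute)
qed

lemma pos_def_imp_invertible:
  fixes G :: "real ^ 'n ^ 'n"
  assumes "\<And>v. v \<noteq> 0 \<Longrightarrow> v \<bullet> (G *v v) > 0"
  shows "invertible G"
proof -
  have "v = 0" if "G *v v = 0" for v
    using assms[of v] that by force
  then show ?thesis
    by (meson invertible_left_inverse matrix_left_invertible_ker)
qed

text \<open>The curve may leave the chart, so it is differentiated on the open set \<open>S\<close> of parameters where it
  stays inside; there \<open>x\<close> is of class \<open>C\<^sup>k\<^sup>+\<^sup>1\<close>, just enough for \<open>y\<^sup>(\<^sup>k\<^sup>)\<close> to be differentiable.\<close>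

theorem theorem5p7p1:
  fixes A :: "('m::{t2_space, second_countable_topology}, 'n::finite) chart set"
    and g :: "('m, 'n) chart \<Rightarrow> real ^ 'n \<Rightarrow> real ^ 'n ^ 'n"
    and T :: "('m, 'n) chart \<Rightarrow> real ^ 'n \<Rightarrow> real ^ 'n \<Rightarrow> real"
    and F :: "('m, 'n) chart \<Rightarrow> 'n jet \<Rightarrow> real ^ 'n"
    and k :: nat
    and U :: "'m set" and \<phi> :: "'m \<Rightarrow> real ^ 'n"
    and I :: "real set" and c :: "real \<Rightarrow> 'm" and x :: "real \<Rightarrow> real ^ 'n"
    and \<gamma> :: "real ^ 'n \<Rightarrow> real ^ 'n ^ 'n" and t :: real
  assumes "k \<ge> 1"
    and "riemannian_mechanical_system A g T k F"
    and "(U, \<phi>) \<in> A" and "\<gamma> = g (U, \<phi>)"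
    and "Ck_curve A (k + 1) I c" and "x = \<phi> \<circ> c"
    and "t \<in> I" and "c t \<in> U"
  shows "(\<forall>i. deriv (\<lambda>s. jet_pd k i (lagrangian k \<gamma>) (jet k x s)) t
              - jet_pd (k - 1) i (lagrangian k \<gamma>) (jet k x t)
            = lower_index \<gamma> (F (U, \<phi>)) i (jet k x t))
     \<longleftrightarrow> (\<forall>i. higher_deriv (k + 1) x t $ i + fact (k + 1) * spray_coeff k \<gamma> i (jet k x t)
            = 1/2 * fact k * F (U, \<phi>) (jet k x t) $ i)"
proof -
  define V where "V = \<phi> ` U"
  define S where "S = {t \<in> I. c t \<in> U}"
  have atlas: "smooth_atlas A" and metric: "riemannian_metric A g"
    using assms(2) by (auto simp: riemannian_mechanical_system_def)
  have U: "open U" and V: "open V"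
    using atlas assms(3) by (auto simp: smooth_atlas_def V_def)
  have \<gamma>: "smooth_on V \<gamma>"
    using metric assms(3,4) by (auto simp: riemannian_metric_def V_def)
  have sym: "transpose (\<gamma> p) = \<gamma> p" if "p \<in> V" for p
    using metric assms(3,4) that by (auto simp: riemannian_metric_def V_def)
  have inv: "invertible (\<gamma> p)" if "p \<in> V" for p
    using metric assms(3,4) that
    by (intro pos_def_imp_invertible) (auto simp: riemannian_metric_def V_def)
  have S: "open S"
  proof -
    have "open I" "continuous_on I c" using assms(5) by (auto simp: Ck_curve_def)
    moreover have "S = I \<inter> c -` U" by (auto simp: S_def)
    ultimately show ?thesis using continuous_on_open_vimage U by (metis Int_commute)
  qed
  have x: "Ck_on (Suc k) S x"
    using assms(3,5,6) by (auto simp: Ck_curve_def S_def)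
  have t: "t \<in> S" "x t \<in> V" using assms(6-8) by (auto simp: S_def V_def)

  let ?y = "jet k x t" and ?L = "lagrangian k \<gamma>"
  let ?q = "higher_deriv (Suc k) x t" and ?f = "F (U, \<phi>) (jet k x t)"
  \<comment> \<open>the Lagrange expression without the term containing the highest derivative\<close>
  define a where "a = (\<chi> i. Gamma_op k (jet_pd k i ?L) ?y - jet_pd (k - 1) i ?L ?y)"
  have y0: "?y 0 = x t" by (simp add: jet_def higher_deriv_def)
  have lagrange: "deriv (\<lambda>s. jet_pd k i ?L (jet k x s)) t =
      Gamma_op k (jet_pd k i ?L) ?y + 2 / fact k * (\<gamma> (x t) *v ?q) $ i" for i
    by (rule lagrange_expression_along_jet[where \<gamma> = \<gamma>, OF V \<gamma> inv sym assms(1) S x t])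
  have "(\<forall>i. deriv (\<lambda>s. jet_pd k i ?L (jet k x s)) t - jet_pd (k - 1) i ?L ?y
            = lower_index \<gamma> (F (U, \<phi>)) i ?y) \<longleftrightarrow>
      a + (1 / (fact k / 2)) *\<^sub>R (\<gamma> (x t) *v ?q) = \<gamma> (x t) *v ?f"
    by (simp add: lagrange vec_eq_iff a_def lower_index_def y0 matrix_vector_mult_def algebra_simps)
  also have "\<dots> \<longleftrightarrow> ?q + (fact k / 2) *\<^sub>R (matrix_inv (\<gamma> (x t)) *v a) = (fact k / 2) *\<^sub>R ?f"
    by (rule solve_for_highest_derivative) (use inv t in auto)
  also have "\<dots> \<longleftrightarrow> (\<forall>i. higher_deriv (k + 1) x t $ i + fact (k + 1) * spray_coeff k \<gamma> i ?y
            = 1/2 * fact k * ?f $ i)"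
  proof -
    have "spray_coeff k \<gamma> i ?y = 1 / real (k + 1) * (1 / 2 * (matrix_inv (\<gamma> (x t)) *v a) $ i)" for i
      by (simp add: spray_coeff_def y0 a_def matrix_vector_mult_def)
    then have "real (k + 1) * spray_coeff k \<gamma> i ?y = 1 / 2 * (matrix_inv (\<gamma> (x t)) *v a) $ i" for i
      by (simp del: of_nat_Suc of_nat_add)
    moreover have "fact (k + 1) * spray_coeff k \<gamma> i ?y = fact k * (real (k + 1) * spray_coeff k \<gamma> i ?y)" for i
      by (simp add: algebra_simps)
    ultimately have spray: "fact (k + 1) * spray_coeff k \<gamma> i ?y = (fact k / 2) * (matrix_inv (\<gamma> (x t)) *v a) $ i" for i
      by (simp only:)
    show ?thesis unfolding spray vec_eq_iff by simp
  qed
  finally show ?thesis .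
qed

end
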